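(* Let $a_1,\dots,a_6,\lambda,\mu\in\mathbb C\setminus\{0\}$ with $\max_i|a_i|<1$, $|q\lambda\mu|<|a_{123456}|<1$, and $a_j/a_k\notin\{q^m:m\in\mathbb Z\}$ for $j\ne k$ (generic so that all denominators are nonzero). Then $$\int_{-\pi}^{\pi}\frac{(e^{\pm2i\psi},\lambda e^{\pm i\psi},\mu e^{\pm i\psi};q)_\infty}{(a_1e^{\pm i\psi},\dots,a_6e^{\pm i\psi};q)_\infty}d\psi=\frac{2\pi}{(q;q)_\infty}\mathop{\mathrm{Sym}}_{a_1;a_2,\dots,a_6}\frac{(a_1^{-2},a_1\lambda,a_1\mu,\lambda/a_1,\mu/a_1;q)_\infty}{(a_{12},\dots,a_{16},a_2/a_1,\dots,a_6/a_1;q)_\infty}\,{}_{10}W_9\!\left(a_1^2;a_{12},\dots,a_{16},\frac{qa_1}\lambda,\frac{qa_1}\mu;q,\frac{q\lambda\mu}{a_{123456}}\right).$$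
   Context: $q\in\mathbb C$, $0<|q|<1$; $(a;q)_\infty=\prod_{j\ge0}(1-aq^j)$ and $(a_1,\dots,a_k;q)_\infty$ the product; $e^{\pm i\psi}$ as entry means both $e^{i\psi}$ and $e^{-i\psi}$ (similarly $e^{\pm2i\psi}$). $a_{12}=a_1a_2$, $a_{123456}=a_1\cdots a_6$, etc. $\mathop{\mathrm{Sym}}_{a_1;a_2,\dots,a_n}F$ denotes $F$ plus the $n-1$ expressions obtained from $F$ by interchanging $a_1$ with $a_k$, $k=2,\dots,n$. ${}_{r+1}W_r(b;a_4,\dots,a_{r+1};q,z)={}_{r+1}\phi_r\!\left(\begin{smallmatrix}q\sqrt b,-q\sqrt b,b,a_4,\dots,a_{r+1}\\ \sqrt b,-\sqrt b,qb/a_4,\dots,qb/a_{r+1}\end{smallmatrix};q,z\right)$, where ${}_{r+1}\phi_r\!\left(\begin{smallmatrix}a_1,\dots,a_{r+1}\\ b_1,\dots,b_r\end{smallmatrix};q,z\right)=\sum_{k\ge0}\frac{(a_1,\dots,a_{r+1};q)_k}{(q,b_1,\dots,b_r;q)_k}z^k$. *)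

theory Defs
  imports "HOL-Analysis.Analysis"
begin

definition qpinf :: "complex \<Rightarrow> complex \<Rightarrow> complex" where
  "qpinf a q = (\<Prod>j. (1 - a * q ^ j))"

definition qpoch :: "complex \<Rightarrow> complex \<Rightarrow> nat \<Rightarrow> complex" where
  "qpoch a q k = (\<Prod>j<k. (1 - a * q ^ j))"

definition qphi :: "complex list \<Rightarrow> complex list \<Rightarrow> complex \<Rightarrow> complex \<Rightarrow> complex" where
  "qphi as bs q z =
     (\<Sum>k. prod_list (map (\<lambda>a. qpoch a q k) as)
          / (qpoch q q k * prod_list (map (\<lambda>b. qpoch b q k) bs)) * z ^ k)"

definition qW :: "complex \<Rightarrow> complex list \<Rightarrow> complex \<Rightarrow> complex \<Rightarrow> complex" where
  "qW b as q z =
     qphi ([q * csqrt b, - q * csqrt b, b] @ as)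
          ([csqrt b, - csqrt b] @ map (\<lambda>a. q * b / a) as) q z"

definition swp :: "(nat \<Rightarrow> complex) \<Rightarrow> nat \<Rightarrow> nat \<Rightarrow> complex" where
  "swp a k = a(1 := a k, k := a 1)"

definition term2p6 :: "complex \<Rightarrow> complex \<Rightarrow> complex \<Rightarrow> (nat \<Rightarrow> complex) \<Rightarrow> complex" where
  "term2p6 q lam mu a =
     qpinf (inverse (a 1 ^ 2)) q * qpinf (a 1 * lam) q * qpinf (a 1 * mu) q
       * qpinf (lam / a 1) q * qpinf (mu / a 1) q
     / (\<Prod>j\<in>{2..6}. qpinf (a 1 * a j) q * qpinf (a j / a 1) q)
     * qW ((a 1)^2) (map (\<lambda>j. a 1 * a j) [2,3,4,5,6] @ [q * a 1 / lam, q * a 1 / mu]) q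
          (q * lam * mu / (\<Prod>j\<in>{1..6}. a j))"

definition integrand2p6 :: "complex \<Rightarrow> complex \<Rightarrow> complex \<Rightarrow> (nat \<Rightarrow> complex) \<Rightarrow> real \<Rightarrow> complex" where
  "integrand2p6 q lam mu a \<psi> =
     qpinf (cis (2*\<psi>)) q * qpinf (cis (-2*\<psi>)) q
     * qpinf (lam * cis \<psi>) q * qpinf (lam * cis (-\<psi>)) q
     * qpinf (mu * cis \<psi>) q * qpinf (mu * cis (-\<psi>)) q
     / (\<Prod>j\<in>{1..6}. qpinf (a j * cis \<psi>) q * qpinf (a j * cis (-\<psi>)) q)"

end

theory Submission
  imports Defs "HOL-Complex_Analysis.Complex_Analysis"
begin

text \<open>
  With $z = e^{i\psi}$ the integral is, up to the factor $i$, the contour integral of $f(z)/z$ over the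
  unit circle. Shifting the products gives $f(qz) = g(z) f(z)$ with $g$ rational and
  $g(0) = q\lambda\mu/(a_1\cdots a_6)$, a number of modulus less than one. Three things follow from this
  single equation: $f$ decays geometrically on the circles $|z| = \rho |q|^n$ (with $\rho$ chosen so
  that they avoid the poles), the residues at $a_i q^k$ satisfy the first-order recurrence in $k$ of
  the very-well-poised series, and that series converges. So the integral is $2\pi$ times the sum of
  the residues of $f(z)/z$ at all poles $a_i q^k$ in the unit disc.
\<close>

section \<open>The infinite q-shifted factorial\<close>

text \<open>The residue theorem cannot be applied on the whole disc, since the points a_i q^k, where
  f may have poles, accumulate at the origin. It is applied on annuli, and the inner circle is then
  shrunk. The radii shrink by the factor |q| because the difference equation only compares f on
  circles whose radii differ by that factor. The symmetrisation reflects the six geometric sequences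
  of poles: f is symmetric in the a_i, so exchanging a_1 with a_i turns the residues at a_1 q^k into
  those at a_i q^k, and only the first family has to be computed. Genericity enters twice. That a_j
  / a_k is no power of q keeps the poles simple and distinct. That a_i lam q^n and a_i mu q^n differ
  from 1 keeps g finite at the poles; the same quantities are denominators of the series, since q b
  / (q a_1 / lam) = a_1 lam for b = a_1^2.\<close>

lemma summable_norm_geometric_mult:
  fixes a q :: complex
  assumes "norm q < 1"
  shows "summable (\<lambda>j. norm (a * q ^ j))"
  using assms by (auto simp: norm_mult norm_power intro!: summable_mult summable_geometric)

lemma convergent_prod_qpinf:
  fixes a q :: complex
  assumes "norm q < 1"
  shows "convergent_prod (\<lambda>j. 1 - a * q ^ j)"
proof (rule abs_convergent_prod_imp_convergent_prod[OF summable_imp_abs_convergent_prod])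
  show "summable (\<lambda>j. norm (1 - a * q ^ j - 1))"
    using summable_norm_geometric_mult[OF assms] by simp
qed

lemma has_prod_qpinf:
  assumes "norm q < 1"
  shows "(\<lambda>j. 1 - a * q ^ j) has_prod qpinf a q"
  using convergent_prod_qpinf[OF assms] unfolding qpinf_def by (rule convergent_prod_has_prod)

lemma qpinf_step:
  assumes "norm q < 1"
  shows "qpinf a q = (1 - a) * qpinf (a * q) q"
proof -
  have "(\<lambda>j. 1 - a * q ^ j) has_prod ((\<Prod>k<1. 1 - a * q ^ k) * (\<Prod>k. 1 - a * q ^ (k + 1)))"
    by (rule has_prod_ignore_initial_segment'[OF convergent_prod_qpinf[OF assms]])
  with has_prod_qpinf[OF assms, of a] show ?thesis
    by (auto dest: has_prod_unique2 simp: qpinf_def mult_ac)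
qed

text \<open>A product in the sense of \<open>has_prod\<close> has only finitely many zero factors
  and a nonzero limit of the others, so it vanishes only through one of its factors. This is what
  locates the poles.\<close>

lemma qpinf_eq_0_iff:
  assumes "norm q < 1"
  shows "qpinf a q = 0 \<longleftrightarrow> (\<exists>j. a * q ^ j = 1)"
proof -
  have "qpinf a q = 0 \<longleftrightarrow> 0 \<in> range (\<lambda>j. 1 - a * q ^ j)"
    by (rule has_prod_eq_0_iff[OF has_prod_qpinf[OF assms]])
  then show ?thesis
    by (auto simp: image_iff)
qed

lemma qpinf_nonzero:
  assumes "norm q < 1" "norm a < 1"
  shows "qpinf a q \<noteq> 0"
proof
  assume "qpinf a q = 0"
  then obtain j where j: "a * q ^ j = 1"
    using qpinf_eq_0_iff assms by blast
  have "norm (a * q ^ j) \<le> norm a * 1"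
    unfolding norm_mult norm_power using assms by (intro mult_left_mono power_le_one) auto
  then show False
    using j assms by simp
qed

text \<open>On the closed unit ball around \<open>x\<close> the factors differ from 1 by at most
  (|x| + 1) |q|^j, a summable majorant, so the polynomial partial products converge uniformly
  there.\<close>

lemma holomorphic_on_qpinf:
  assumes "norm q < 1"
  shows "(\<lambda>a. qpinf a q) holomorphic_on UNIV"
proof (rule holomorphic_uniform_sequence)
  show "open (UNIV :: complex set)" by simp
  show "(\<lambda>a. \<Prod>j<n. 1 - a * q ^ j) holomorphic_on UNIV" for n
    by (intro holomorphic_intros)
  fix x :: complex
  have "uniformly_convergent_on (cball x 1) (\<lambda>N a. \<Prod>j<N. 1 - a * q ^ j)"
  proof (rule Infinite_Products.uniformly_convergent_on_prod')
    show "uniformly_convergent_on (cball x 1) (\<lambda>N a. \<Sum>j<N. norm (1 - a * q ^ j - 1))"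
    proof (rule Weierstrass_m_test')
      show "norm (norm (1 - a * q ^ j - 1)) \<le> norm (of_real (norm x + 1) * q ^ j)" if "a \<in> cball x 1" for j a
      proof -
        have "norm a \<le> norm x + 1"
          using that norm_triangle_ineq2[of a x] by (simp add: dist_norm norm_minus_commute)
        then show ?thesis
          by (simp add: norm_mult mult_right_mono del: of_real_add)
      qed
      show "summable (\<lambda>j. norm (of_real (norm x + 1) * q ^ j))"
        by (rule summable_norm_geometric_mult[OF assms])
    qed
  qed (auto intro!: continuous_intros)
  moreover have "lim (\<lambda>N. \<Prod>j<N. 1 - a * q ^ j) = qpinf a q" for a
    by (intro limI has_prod_imp_tendsto' has_prod_qpinf assms)
  ultimately have "uniform_limit (cball x 1) (\<lambda>N a. \<Prod>j<N. 1 - a * q ^ j) (\<lambda>a. qpinf a q) sequentially"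
    by (simp add: uniformly_convergent_uniform_limit_iff)
  then show "\<exists>d>0. cball x d \<subseteq> UNIV \<and> uniform_limit (cball x d) (\<lambda>N a. \<Prod>j<N. 1 - a * q ^ j) (\<lambda>a. qpinf a q) sequentially"
    by (intro exI[of _ 1]) auto
qed

lemma holomorphic_on_qpinf_compose:
  assumes "norm q < 1" "g holomorphic_on A"
  shows "(\<lambda>z. qpinf (g z) q) holomorphic_on A"
  using holomorphic_on_compose_gen[OF assms(2) holomorphic_on_qpinf[OF assms(1)]]
  by (simp add: o_def)

lemma tendsto_qpinf:
  assumes "norm q < 1" "(g \<longlongrightarrow> l) A"
  shows "((\<lambda>z. qpinf (g z) q) \<longlongrightarrow> qpinf l q) A"
proof (rule isCont_tendsto_compose[OF _ assms(2)])
  show "isCont (\<lambda>a. qpinf a q) l"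
    using holomorphic_on_imp_continuous_on[OF holomorphic_on_qpinf[OF assms(1)]]
    by (simp add: continuous_on_eq_continuous_at)
qed

section \<open>Residues on an annulus\<close>

text \<open>The homotopy is radial: points of equal parameter lie on one ray from the origin, so the
  segment between them stays in the closed annulus.\<close>

lemma contour_integral_circlepath_eq_homotopic:
  assumes "F holomorphic_on S" "open S" "\<And>z. r \<le> norm z \<Longrightarrow> norm z \<le> R \<Longrightarrow> z \<in> S" "0 < r" "r < R"
  shows "contour_integral (circlepath 0 R) F = contour_integral (circlepath 0 r) F"
proof (rule Cauchy_theorem_homotopic_loops)
  show "homotopic_loops S (circlepath 0 R) (circlepath 0 r)"
  proof (rule homotopic_loops_linear)
    fix t :: real
    show "closed_segment (circlepath 0 R t) (circlepath 0 r t) \<subseteq> S"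
    proof
      fix x assume "x \<in> closed_segment (circlepath 0 R t) (circlepath 0 r t)"
      then obtain u where u: "0 \<le> u" "u \<le> 1"
        and "x = (1 - u) *\<^sub>R circlepath 0 R t + u *\<^sub>R circlepath 0 r t"
        by (auto simp: in_segment)
      then have x: "x = of_real ((1 - u) * R + u * r) * exp (2 * of_real pi * \<i> * of_real t)"
        by (simp add: circlepath scaleR_conv_of_real algebra_simps)
      have 1: "r \<le> (1 - u) * R + u * r"
        using u assms mult_left_mono[of r R "1 - u"] by (simp add: algebra_simps)
      have 2: "(1 - u) * R + u * r \<le> R"
        using u assms mult_left_mono[of r R "u"] by (simp add: algebra_simps)
      have "norm x = (1 - u) * R + u * r"
        unfolding x norm_mult norm_of_real using 1 assms(4) by simp
      then show "x \<in> S"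
        using assms(3) 1 2 by simp
    qed
  qed auto
qed (use assms in auto)

text \<open>All poles are at most simple, so the limit of (z - p) F(z) serves as the residue.
  Subtracting c p / (z - p) removes the singularity at p and does not change the limits at the other
  poles; the induction hypothesis is applied to this difference, hence \<open>F\<close> is
  arbitrary.\<close>

lemma contour_integral_annulus_residues:
  fixes F :: "complex \<Rightarrow> complex"
  assumes "finite P" "open S" and S: "\<And>z. r \<le> norm z \<Longrightarrow> norm z \<le> R \<Longrightarrow> z \<in> S"
    and r: "0 < r" "r < R" and P: "\<And>p. p \<in> P \<Longrightarrow> r < norm p \<and> norm p < R"
    and hol: "F holomorphic_on (S - P)"
    and res: "\<And>p. p \<in> P \<Longrightarrow> ((\<lambda>z. (z - p) * F z) \<longlongrightarrow> c p) (at p)"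
  shows "contour_integral (circlepath 0 R) F
         = contour_integral (circlepath 0 r) F + 2 * pi * \<i> * (\<Sum>p\<in>P. c p)"
  using assms(1) P hol res
proof (induction P arbitrary: F rule: finite_induct)
  case empty
  then show ?case
    using contour_integral_circlepath_eq_homotopic[of F S r R] assms by simp
next
  case (insert p P)
  define g where "g = (\<lambda>z. if z = p then c p else (z - p) * F z)"
  \<comment> \<open>\<open>H\<close> is \<open>F\<close> without its principal part at
    \<open>p\<close>. The value filled in at \<open>p\<close> is the derivative of the extended
    function (z - p) F(z), which makes \<open>H\<close> holomorphic there.\<close>
  define H where "H = (\<lambda>z. if z = p then deriv g p else F z - c p / (z - p))"
  have opn: "open (S - P)"
    using assms(2) insert.hyps by (simp add: open_Diff finite_imp_closed)
  have pS: "p \<in> S - P"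
    using S insert.prems(1)[of p] insert.hyps by auto
  have "g holomorphic_on (S - P)"
    unfolding g_def
  proof (rule removable_singularity)
    have "S - insert p P = S - P - {p}" by auto
    then show "(\<lambda>z. (z - p) * F z) holomorphic_on (S - P - {p})"
      using insert.prems(2) by (auto intro!: holomorphic_intros)
    show "((\<lambda>z. (z - p) * F z) \<longlongrightarrow> c p) (at p)"
      by (rule insert.prems) simp
  qed (rule opn)
  then have "(\<lambda>z. if z = p then deriv g p else F z - g p / (z - p)) holomorphic_on (S - P)"
    by (rule pole_theorem_open[OF _ opn]) (auto simp: g_def)
  also have "(\<lambda>z. if z = p then deriv g p else F z - g p / (z - p)) = H"
    by (auto simp: H_def g_def)
  finally have H: "H holomorphic_on (S - P)" .
  have IH: "contour_integral (circlepath 0 R) H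
         = contour_integral (circlepath 0 r) H + 2 * pi * \<i> * (\<Sum>p\<in>P. c p)"
  proof (rule insert.IH[OF _ H])
    fix p' assume p': "p' \<in> P"
    then have ne: "p' \<noteq> p" using insert.hyps by auto
    have "((\<lambda>z. (z - p') * F z - (z - p') * (c p / (z - p))) \<longlongrightarrow> c p' - (p' - p') * (c p / (p' - p))) (at p')"
      using ne by (intro tendsto_intros insert.prems) (auto simp: p')
    then have "((\<lambda>z. (z - p') * F z - (z - p') * (c p / (z - p))) \<longlongrightarrow> c p') (at p')"
      by simp
    moreover have "eventually (\<lambda>z. z \<noteq> p) (at p')"
      by (rule eventually_neq_at_within)
    then have "eventually (\<lambda>z. (z - p') * F z - (z - p') * (c p / (z - p)) = (z - p') * H z) (at p')"
      by eventually_elim (simp add: H_def algebra_simps)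
    ultimately show "((\<lambda>z. (z - p') * H z) \<longlongrightarrow> c p') (at p')"
      using tendsto_cong by fast
  qed (use insert.prems in auto)
  have Fint: "F contour_integrable_on circlepath 0 \<rho>" if "\<rho> \<in> {r, R}" for \<rho>
  proof (rule contour_integrable_continuous_circlepath)
    have "path_image (circlepath 0 \<rho>) \<subseteq> S - insert p P"
      using that S r insert.prems(1) by (fastforce simp: path_image_circlepath dist_norm)
    then show "continuous_on (path_image (circlepath 0 \<rho>)) F"
      using insert.prems(2) holomorphic_on_imp_continuous_on continuous_on_subset by blast
  qed
  have Heq: "contour_integral (circlepath 0 \<rho>) H = contour_integral (circlepath 0 \<rho>) F - k"
    if \<rho>: "\<rho> \<in> {r, R}" and k: "((\<lambda>z. c p / (z - p)) has_contour_integral k) (circlepath 0 \<rho>)" for \<rho> k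
  proof (rule contour_integral_unique, rule has_contour_integral_eq)
    show "((\<lambda>z. F z - c p / (z - p)) has_contour_integral contour_integral (circlepath 0 \<rho>) F - k) (circlepath 0 \<rho>)"
      by (intro has_contour_integral_diff k has_contour_integral_integral Fint \<rho>)
    show "F z - c p / (z - p) = H z" if "z \<in> path_image (circlepath 0 \<rho>)" for z
      using that \<rho> r insert.prems(1)[of p] by (auto simp: H_def path_image_circlepath)
  qed
  have "((\<lambda>z. c p / (z - p)) has_contour_integral 2 * of_real pi * \<i> * c p) (circlepath 0 R)"
    by (rule Cauchy_integral_circlepath[of 0 R "\<lambda>_. c p"])
      (use insert.prems(1)[of p] in \<open>auto intro!: continuous_intros holomorphic_intros\<close>)
  from Heq[OF _ this]
  have R: "contour_integral (circlepath 0 R) H = contour_integral (circlepath 0 R) F - 2 * of_real pi * \<i> * c p"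
    by simp
  \<comment> \<open>The inner circle lies in a disc around 0 that does not contain \<open>p\<close>,
    so the principal part contributes only on the outer circle.\<close>
  have "((\<lambda>z. c p / (z - p)) has_contour_integral 0) (circlepath 0 r)"
    by (rule Cauchy_theorem_convex_simple[of _ "ball 0 (norm p)"])
      (use r insert.prems(1)[of p] in \<open>auto intro!: holomorphic_intros simp: path_image_circlepath\<close>)
  from Heq[OF _ this]
  have r: "contour_integral (circlepath 0 r) H = contour_integral (circlepath 0 r) F"
    by simp
  show ?case
    using IH R r insert.hyps by (simp add: algebra_simps)
qed

section \<open>Very-well-poised series\<close>

lemma qpoch_0 [simp]: "qpoch a q 0 = 1"
  by (simp add: qpoch_def)

lemma qpoch_Suc: "qpoch a q (Suc k) = qpoch a q k * (1 - a * q ^ k)"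
  by (simp add: qpoch_def)

lemma prod_list_qpoch_Suc:
  "prod_list (map (\<lambda>a. qpoch a q (Suc k)) as)
   = prod_list (map (\<lambda>a. qpoch a q k) as) * prod_list (map (\<lambda>a. 1 - a * q ^ k) as)"
  by (induction as) (simp_all add: qpoch_Suc)

definition qphi_summand :: "complex list \<Rightarrow> complex list \<Rightarrow> complex \<Rightarrow> complex \<Rightarrow> nat \<Rightarrow> complex" where
  "qphi_summand as bs q z k =
     prod_list (map (\<lambda>a. qpoch a q k) as)
       / (qpoch q q k * prod_list (map (\<lambda>b. qpoch b q k) bs)) * z ^ k"

lemma qphi_summand_0 [simp]: "qphi_summand as bs q z 0 = 1"
  by (simp add: qphi_summand_def map_replicate_const)

lemma qphi_summand_Suc:
  "qphi_summand as bs q z (Suc k) =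
     prod_list (map (\<lambda>a. 1 - a * q ^ k) as)
       / ((1 - q * q ^ k) * prod_list (map (\<lambda>b. 1 - b * q ^ k) bs)) * z * qphi_summand as bs q z k"
  unfolding qphi_summand_def prod_list_qpoch_Suc qpoch_Suc[of q] by (simp only: power_Suc mult_ac times_divide_times_eq times_divide_eq_left times_divide_eq_right
      divide_divide_eq_left)

definition qW_summand :: "complex \<Rightarrow> complex list \<Rightarrow> complex \<Rightarrow> complex \<Rightarrow> nat \<Rightarrow> complex" where
  "qW_summand b as q z =
     qphi_summand ([q * csqrt b, - q * csqrt b, b] @ as)
       ([csqrt b, - csqrt b] @ map (\<lambda>a. q * b / a) as) q z"

lemma qW_eq_suminf: "qW b as q z = (\<Sum>k. qW_summand b as q z k)"
  by (simp add: qW_def qphi_def qW_summand_def qphi_summand_def)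

lemma qW_summand_0 [simp]: "qW_summand b as q z 0 = 1"
  by (simp add: qW_summand_def)

text \<open>The square roots come in pairs of opposite sign, and (1 - x sqrt b)(1 + x sqrt b) = 1 -
  b x^2. The ratio of consecutive terms is therefore rational in b and free of the branch chosen by
  \<open>csqrt\<close>.\<close>

lemma qW_summand_Suc:
  "qW_summand b as q z (Suc k) =
     ((1 - b * (q * q ^ k)\<^sup>2) * (1 - b * q ^ k) * prod_list (map (\<lambda>a. 1 - a * q ^ k) as))
       / ((1 - q * q ^ k) * (1 - b * (q ^ k)\<^sup>2) * prod_list (map (\<lambda>a. 1 - q * b / a * q ^ k) as))
       * z * qW_summand b as q z k"
proof -
  have b: "(1 - x * csqrt b) * (1 + x * csqrt b) = 1 - b * x\<^sup>2" for x
    using power2_csqrt[of b] by (simp add: algebra_simps power2_eq_square)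
  have "(1 - q * csqrt b * q ^ k) * (1 - - q * csqrt b * q ^ k) = 1 - b * (q * q ^ k)\<^sup>2"
    "(1 - csqrt b * q ^ k) * (1 - - csqrt b * q ^ k) = 1 - b * (q ^ k)\<^sup>2"
    using b[of "q * q ^ k"] b[of "q ^ k"] by (simp_all add: mult_ac)
  then show ?thesis
    unfolding qW_summand_def qphi_summand_Suc by (simp add: o_def flip: mult.assoc)
qed

section \<open>The integrand and its q-difference equation\<close>

definition aw_fun :: "complex \<Rightarrow> complex \<Rightarrow> complex \<Rightarrow> (nat \<Rightarrow> complex) \<Rightarrow> complex \<Rightarrow> complex" where
  "aw_fun q lam mu a z =
     qpinf (z\<^sup>2) q * qpinf (1 / z\<^sup>2) q * qpinf (lam * z) q * qpinf (lam / z) q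
       * qpinf (mu * z) q * qpinf (mu / z) q
     / (\<Prod>j\<in>{1..6}. qpinf (a j * z) q * qpinf (a j / z) q)"

text \<open>The multiplier g. The powers of z produced by the six products in 1 / z of the
  denominator balance those produced by the numerator, so g is regular at 0.\<close>

definition aw_ratio :: "complex \<Rightarrow> complex \<Rightarrow> complex \<Rightarrow> (nat \<Rightarrow> complex) \<Rightarrow> complex \<Rightarrow> complex" where
  "aw_ratio q lam mu a z =
     q * (1 - (q * z)\<^sup>2) * (lam - q * z) * (mu - q * z) / ((1 - z\<^sup>2) * (1 - lam * z) * (1 - mu * z))
       * (\<Prod>j\<in>{1..6}. (1 - a j * z) / (a j - q * z))"

text \<open>Replacing z by q z drops the first factor of a product in c z and adds the factor 1 - c
  / (q z) to a product in c / z. The products in z^2 and 1 / z^2 move by two factors, and the two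
  occurrences of 1 - q z^2 cancel.\<close>

lemma aw_fun_q_shift:
  assumes q: "q \<noteq> 0" "norm q < 1" and z: "z \<noteq> 0" "norm z < 1" "lam * z \<noteq> 1" "mu * z \<noteq> 1"
    and a: "\<forall>j\<in>{1..6}. norm (a j) < 1"
  shows "aw_fun q lam mu a (q * z) = aw_ratio q lam mu a z * aw_fun q lam mu a z"
proof -
  note step = qpinf_step[OF q(2)]
  have small: "x \<noteq> 1" if "norm x < 1" for x :: complex
    using that by auto
  have mult_small: "x * y \<noteq> 1" if "norm x < 1" "norm y < 1" for x y :: complex
    using norm_mult_less[OF that] by (intro small) simp
  have z2: "z\<^sup>2 \<noteq> 1" "q * z\<^sup>2 \<noteq> 1"
    using mult_small[OF z(2) z(2)] mult_small[OF q(2), of "z * z"] norm_mult_less[OF z(2) z(2)]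
    by (simp_all add: power2_eq_square)
  have e1: "qpinf ((q * z)\<^sup>2) q = qpinf (z\<^sup>2) q / ((1 - z\<^sup>2) * (1 - q * z\<^sup>2))"
  proof -
    have "qpinf (z\<^sup>2) q = (1 - z\<^sup>2) * ((1 - q * z\<^sup>2) * qpinf ((q * z)\<^sup>2) q)"
      using step[of "z\<^sup>2"] step[of "z\<^sup>2 * q"] by (simp add: power2_eq_square mult_ac)
    then show ?thesis
      using z2 by simp
  qed
  have e2: "qpinf (1 / (q * z)\<^sup>2) q = (1 - (q * z)\<^sup>2) * (1 - q * z\<^sup>2) / (q ^ 3 * z ^ 4) * qpinf (1 / z\<^sup>2) q"
  proof -
    have "qpinf (1 / (q * z)\<^sup>2) q = (1 - 1 / (q * z)\<^sup>2) * ((1 - 1 / (q * z\<^sup>2)) * qpinf (1 / z\<^sup>2) q)"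
    proof -
      have "1 / (q * z)\<^sup>2 * q = 1 / (q * z\<^sup>2)" "1 / (q * z\<^sup>2) * q = 1 / z\<^sup>2"
        using q(1) by (simp_all add: power2_eq_square)
      with step[of "1 / (q * z)\<^sup>2"] step[of "1 / (q * z\<^sup>2)"] show ?thesis
        by simp
    qed
    also have "\<dots> = (1 - 1 / (q * z)\<^sup>2) * (1 - 1 / (q * z\<^sup>2)) * qpinf (1 / z\<^sup>2) q"
      by simp
    also have "(1 - 1 / (q * z)\<^sup>2) * (1 - 1 / (q * z\<^sup>2)) = (1 - (q * z)\<^sup>2) * (1 - q * z\<^sup>2) / (q ^ 3 * z ^ 4)"
    proof -
      have "(1 - 1 / A) * (1 - 1 / B) = (1 - A) * (1 - B) / (A * B)" if "A \<noteq> 0" "B \<noteq> 0" for A B :: complex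
        using that by (simp add: field_simps)
      moreover have "(q * z)\<^sup>2 * (q * z\<^sup>2) = q ^ 3 * z ^ 4"
        by (simp add: eval_nat_numeral)
      ultimately show ?thesis
        using q(1) z(1) by simp
    qed
    finally show ?thesis .
  qed
  have e3: "qpinf (c * (q * z)) q = qpinf (c * z) q / (1 - c * z)" if "c * z \<noteq> 1" for c
    using step[of "c * z"] that by (simp add: mult_ac)
  have e4: "qpinf (c / (q * z)) q = - (c - q * z) / (q * z) * qpinf (c / z) q" for c
    using step[of "c / (q * z)"] q(1) z(1) by (simp add: field_simps)
  \<comment> \<open>The case a j = q z is included: the left side then has a zero factor, and the
    right side is zero because division by zero gives zero.\<close>
  have e5: "qpinf (a j * (q * z)) q * qpinf (a j / (q * z)) q
      = (qpinf (a j * z) q * qpinf (a j / z) q) / ((1 - a j * z) / (a j - q * z)) / (- (q * z))" if "j \<in> {1..6}" for j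
  proof -
    have "a j * z \<noteq> 1"
      using a that z by (intro mult_small) auto
    then show ?thesis
      unfolding e4 by (simp add: e3 del: minus_diff_eq)
  qed
  have P: "(\<Prod>j\<in>{1..6}. qpinf (a j * (q * z)) q * qpinf (a j / (q * z)) q)
     = (\<Prod>j\<in>{1..6}. qpinf (a j * z) q * qpinf (a j / z) q) / (\<Prod>j\<in>{1..6}. (1 - a j * z) / (a j - q * z)) / (q * z) ^ 6"
  proof -
    have "(\<Prod>j\<in>{1..6}. qpinf (a j * (q * z)) q * qpinf (a j / (q * z)) q)
      = (\<Prod>j\<in>{1..6}. (qpinf (a j * z) q * qpinf (a j / z) q) / ((1 - a j * z) / (a j - q * z)) / (- (q * z)))"
      by (rule prod.cong[OF refl e5])
    then show ?thesis
      unfolding prod_dividef prod_constant by simp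
  qed
  have alg: "X1 / ((1 - z\<^sup>2) * (1 - q * z\<^sup>2)) * ((1 - (q * z)\<^sup>2) * (1 - q * z\<^sup>2) / (q ^ 3 * z ^ 4) * X2)
     * (X3 / L) * (- L' / (q * z) * X4) * (X5 / M) * (- M' / (q * z) * X6) / (Y / G / (q * z) ^ 6)
     = q * (1 - (q * z)\<^sup>2) * L' * M' / ((1 - z\<^sup>2) * L * M) * G * (X1 * X2 * X3 * X4 * X5 * X6 / Y)"
    for X1 X2 X3 X4 X5 X6 Y G L M L' M'
  proof -
    \<comment> \<open>The balance of powers: the product in 1 / z^2 brings q^3 z^4, those in lam / z
      and mu / z bring q z each, and the six in a_j / z bring (q z)^6. A single q is left.\<close>
    have c: "(q * z) ^ 6 / (q ^ 3 * z ^ 4 * (q * z) * (q * z)) = q"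
      using q z by (simp add: eval_nat_numeral)
    have "X1 / ((1 - z\<^sup>2) * (1 - q * z\<^sup>2)) * ((1 - (q * z)\<^sup>2) * (1 - q * z\<^sup>2) / (q ^ 3 * z ^ 4) * X2)
     * (X3 / L) * (- L' / (q * z) * X4) * (X5 / M) * (- M' / (q * z) * X6) / (Y / G / (q * z) ^ 6)
     = ((q * z) ^ 6 / (q ^ 3 * z ^ 4 * (q * z) * (q * z))) * ((1 - q * z\<^sup>2) / (1 - q * z\<^sup>2)) * (1 - (q * z)\<^sup>2) * L' * M' / ((1 - z\<^sup>2) * L * M) * G * (X1 * X2 * X3 * X4 * X5 * X6 / Y)"
      by (simp only: divide_inverse inverse_mult_distrib inverse_inverse_eq mult_minus_left mult_minus_right
          minus_minus mult_ac)
    then show ?thesis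
      unfolding c using z2 by simp
  qed
  show ?thesis
    unfolding aw_fun_def aw_ratio_def P e1 e2 e4[of lam] e4[of mu] e3[OF z(3)] e3[OF z(4)] by (rule alg)
qed

lemma prod_1_6: "(\<Prod>j\<in>{1..6}. f j) = f 1 * f 2 * f 3 * f 4 * f 5 * f (6::nat)"
  for f :: "nat \<Rightarrow> 'a::comm_monoid_mult"
  by (simp add: numeral_eq_Suc prod.atLeast_Suc_atMost mult_ac)

lemma prod_2_6: "(\<Prod>j\<in>{2..6}. f j) = f 2 * f 3 * f 4 * f 5 * f (6::nat)"
  for f :: "nat \<Rightarrow> 'a::comm_monoid_mult"
  by (simp add: numeral_eq_Suc prod.atLeast_Suc_atMost mult_ac)

definition aw_summand :: "complex \<Rightarrow> complex \<Rightarrow> complex \<Rightarrow> (nat \<Rightarrow> complex) \<Rightarrow> nat \<Rightarrow> complex" where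
  "aw_summand q lam mu a =
     qW_summand ((a 1)\<^sup>2) (map (\<lambda>j. a 1 * a j) [2,3,4,5,6] @ [q * a 1 / lam, q * a 1 / mu]) q
       (q * lam * mu / (\<Prod>j\<in>{1..6}. a j))"

text \<open>With b = a_1^2 and z = a_1 q^k, every factor in the ratio of the very-well-poised series
  is a factor of g(z) up to a constant. The parameter q a_1 / lam yields lam - q z above and,
  through its well-poised partner a_1 lam, 1 - lam z below; likewise for mu. The leftover constants
  a_j, lam and mu cancel against the argument of the series.\<close>

lemma aw_summand_Suc:
  assumes nz: "\<forall>i\<in>{1..6}. a i \<noteq> 0" "lam \<noteq> 0" "mu \<noteq> 0" "q \<noteq> 0"
  shows "aw_summand q lam mu a (Suc k) = aw_ratio q lam mu a (a 1 * q ^ k) * aw_summand q lam mu a k"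
proof -
  define x where "x = q ^ k"
  define z where "z = a 1 * x"
  have a: "a 1 \<noteq> 0" "a 2 \<noteq> 0" "a 3 \<noteq> 0" "a 4 \<noteq> 0" "a 5 \<noteq> 0" "a 6 \<noteq> 0"
    using nz(1) by auto
  have d: "1 - q * (a 1)\<^sup>2 / (a 1 * c) * x = (c - q * z) / c" if "c \<noteq> 0" for c
    using that a(1) by (simp add: z_def field_simps power2_eq_square)
  have d': "1 - q * (a 1)\<^sup>2 / (q * a 1 / c) * x = 1 - c * z" if "c \<noteq> 0" for c
    using that a(1) nz by (simp add: z_def field_simps power2_eq_square)
  have d'': "1 - q * a 1 / c * x = (c - q * z) / c" if "c \<noteq> 0" for c
    using that by (simp add: z_def field_simps)
  have d1: "1 - q * x = (a 1 - q * z) / a 1"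
    using a(1) by (simp add: z_def field_simps)
  \<comment> \<open>The nesting and the trailing 1 are the shape of the unfolded
    \<open>prod_list\<close>. Only the nonzero constants collected in \<open>A\<close> are
    cancelled, so the other denominators may be arbitrary.\<close>
  have alg: "S1 * N1 * (N2 * (N3 * (N4 * (N5 * (N6 * (L / lam * (M / mu * 1)))))))
      / (D1 / a 1 * S2 * (D2 / a 2 * (D3 / a 3 * (D4 / a 4 * (D5 / a 5 * (D6 / a 6 * (l * (m * 1))))))))
      * (q * lam * mu / (a 1 * a 2 * a 3 * a 4 * a 5 * a 6)) * W
    = q * S1 * L * M / (S2 * l * m) * (N1 / D1 * (N2 / D2) * (N3 / D3) * (N4 / D4) * (N5 / D5) * (N6 / D6)) * W"
    for S1 S2 N1 N2 N3 N4 N5 N6 D1 D2 D3 D4 D5 D6 L M l m W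
  proof -
    define A where "A = lam * mu * (a 1 * a 2 * a 3 * a 4 * a 5 * a 6)"
    have "A \<noteq> 0"
      using nz a by (simp add: A_def)
    have "S1 * N1 * (N2 * (N3 * (N4 * (N5 * (N6 * (L / lam * (M / mu * 1)))))))
      / (D1 / a 1 * S2 * (D2 / a 2 * (D3 / a 3 * (D4 / a 4 * (D5 / a 5 * (D6 / a 6 * (l * (m * 1))))))))
      * (q * lam * mu / (a 1 * a 2 * a 3 * a 4 * a 5 * a 6)) * W
    = A / A * (q * S1 * L * M / (S2 * l * m) * (N1 / D1 * (N2 / D2) * (N3 / D3) * (N4 / D4) * (N5 / D5) * (N6 / D6)) * W)"
      unfolding A_def by (simp only: divide_inverse inverse_mult_distrib inverse_inverse_eq mult_1_right mult_1_left inverse_1 mult_ac)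
    then show ?thesis
      using \<open>A \<noteq> 0\<close> by simp
  qed
  have n: "1 - a 1 * c * x = 1 - c * z" for c
    by (simp add: z_def)
  have s: "1 - (a 1)\<^sup>2 * (q * x)\<^sup>2 = 1 - (q * z)\<^sup>2" "1 - (a 1)\<^sup>2 * x\<^sup>2 = 1 - z\<^sup>2" "1 - (a 1)\<^sup>2 * x = 1 - a 1 * z"
    by (simp_all add: z_def power_mult_distrib power2_eq_square)
  show ?thesis
    unfolding aw_summand_def qW_summand_Suc aw_ratio_def x_def[symmetric] z_def[symmetric] s prod_1_6
      list.map append.simps prod_list.Cons prod_list.Nil d1 n
      d[OF a(2)] d[OF a(3)] d[OF a(4)] d[OF a(5)] d[OF a(6)] d'[OF nz(2)] d'[OF nz(3)] d''[OF nz(2)] d''[OF nz(3)]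
    by (rule alg)
qed

definition aw_prefactor :: "complex \<Rightarrow> complex \<Rightarrow> complex \<Rightarrow> (nat \<Rightarrow> complex) \<Rightarrow> complex" where
  "aw_prefactor q lam mu a =
     qpinf (inverse (a 1 ^ 2)) q * qpinf (a 1 * lam) q * qpinf (a 1 * mu) q
       * qpinf (lam / a 1) q * qpinf (mu / a 1) q
     / (\<Prod>j\<in>{2..6}. qpinf (a 1 * a j) q * qpinf (a j / a 1) q)"

lemma term2p6_eq: "term2p6 q lam mu a = aw_prefactor q lam mu a * (\<Sum>k. aw_summand q lam mu a k)"
  by (simp add: term2p6_def aw_prefactor_def qW_eq_suminf aw_summand_def)

section \<open>Residues of the integrand\<close>

text \<open>These assumptions are invariant under exchanging a_1 with a_i, so an interpretation with
  \<open>swp a i\<close> carries every result about the poles a_1 q^k over to the poles a_i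
  q^k.\<close>

locale aw_params =
  fixes q lam mu :: complex and a :: "nat \<Rightarrow> complex"
  assumes q_nz: "q \<noteq> 0" and q_less: "norm q < 1"
    and a_nz: "\<And>i. i \<in> {1..6} \<Longrightarrow> a i \<noteq> 0" and lam_nz: "lam \<noteq> 0" and mu_nz: "mu \<noteq> 0"
    and a_less: "\<And>i. i \<in> {1..6} \<Longrightarrow> norm (a i) < 1"
    and prod_less: "norm (q * lam * mu) < norm (\<Prod>j\<in>{1..6}. a j)"
    and generic: "\<And>j k m::int. j \<in> {1..6} \<Longrightarrow> k \<in> {1..6} \<Longrightarrow> j \<noteq> k \<Longrightarrow> a j / a k \<noteq> q powi m"
    and generic_lam: "\<And>i n. i \<in> {1..6} \<Longrightarrow> a i * lam * q ^ n \<noteq> 1"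
    and generic_mu: "\<And>i n. i \<in> {1..6} \<Longrightarrow> a i * mu * q ^ n \<noteq> 1"
begin

lemma nz: "\<forall>i\<in>{1..6}. a i \<noteq> 0" "lam \<noteq> 0" "mu \<noteq> 0" "q \<noteq> 0"
  using a_nz lam_nz mu_nz q_nz by auto

lemma norm_a_q_power_less: "norm (a i * q ^ k) < 1" if "i \<in> {1..6}"
proof -
  have "norm (a i * q ^ k) \<le> norm (a i) * 1"
    unfolding norm_mult norm_power using q_less by (intro mult_left_mono power_le_one) auto
  then show ?thesis
    using a_less[OF that] by simp
qed

text \<open>Different families are kept apart by \<open>generic\<close>, members of one family by
  their moduli, as |q|^m is strictly decreasing. Hence the poles are simple and can be indexed by
  pairs.\<close>

lemma a_q_power_inj:
  assumes "j \<in> {1..6}" "k \<in> {1..6}" "a j * q ^ m = a k * q ^ n"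
  shows "j = k \<and> m = n"
proof -
  have "j = k"
  proof (rule ccontr)
    assume "j \<noteq> k"
    have "a j / a k = q powi (int n - int m)"
      using assms(3) a_nz[OF assms(2)] q_nz by (simp add: power_int_diff field_simps)
    with generic[OF assms(1,2) \<open>j \<noteq> k\<close>] show False by blast
  qed
  moreover have "m = n"
  proof -
    have "norm q ^ m = norm q ^ n"
      using assms a_nz[OF assms(1)] \<open>j = k\<close> by (simp flip: norm_power)
    then show ?thesis
      using q_nz q_less power_inject_exp'[of "norm q" m n] by simp
  qed
  ultimately show ?thesis by simp
qed

text \<open>The pole comes from the first factor of (a_1 / z; q), which is (z - a_1) / z and cancels
  both z - a_1 and the 1 / z. The rest of that product becomes (q; q) at a_1, while (a_1^2; q)
  occurs above as the product in z^2 and below as the one in a_1 z, and drops out.\<close>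

lemma tendsto_aw_fun_first_pole:
  "((\<lambda>z. (z - a 1) * (aw_fun q lam mu a z / z)) \<longlongrightarrow> aw_prefactor q lam mu a / qpinf q q) (at (a 1))"
proof -
  have a: "a 1 \<noteq> 0" "norm (a 1) < 1"
    using a_nz a_less by auto
  have nzQ: "qpinf (a j * a 1) q \<noteq> 0" if "j \<in> {1..6}" for j
    using norm_mult_less[OF a_less[OF that] a(2)] by (intro qpinf_nonzero q_less) simp
  have nzQ': "qpinf (a j / a 1) q \<noteq> 0" if "j \<in> {2..6}" for j
  proof
    assume "qpinf (a j / a 1) q = 0"
    then obtain n where "a j / a 1 * q ^ n = 1"
      using qpinf_eq_0_iff[OF q_less] by blast
    then have "a j * q ^ n = a 1 * q ^ 0"
      using a by (simp add: field_simps)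
    then show False
      using a_q_power_inj[of j 1 n 0] that by auto
  qed
  have nzq: "qpinf q q \<noteq> 0"
    by (rule qpinf_nonzero[OF q_less q_less])
  define N where "N = (\<lambda>z. qpinf (z\<^sup>2) q * qpinf (1 / z\<^sup>2) q * qpinf (lam * z) q * qpinf (lam / z) q
       * qpinf (mu * z) q * qpinf (mu / z) q)"
  define M where "M = (\<lambda>z. qpinf (a 1 * z) q * qpinf (a 1 * q / z) q
       * (\<Prod>j\<in>{2..6}. qpinf (a j * z) q * qpinf (a j / z) q))"
  have M: "M (a 1) = qpinf ((a 1)\<^sup>2) q * qpinf q q * (\<Prod>j\<in>{2..6}. qpinf (a 1 * a j) q * qpinf (a j / a 1) q)"
    using a(1) by (simp add: M_def power2_eq_square mult_ac)
  have "M (a 1) \<noteq> 0"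
    unfolding M using nzQ nzQ' nzq nzQ[of 1] by (auto simp: power2_eq_square mult_ac)
  have "((\<lambda>z. N z / M z) \<longlongrightarrow> N (a 1) / M (a 1)) (at (a 1))"
    unfolding N_def M_def
    by (intro tendsto_intros tendsto_qpinf q_less)
      (use a \<open>M (a 1) \<noteq> 0\<close> in \<open>auto simp: M_def\<close>)
  also have "N (a 1) / M (a 1) = aw_prefactor q lam mu a / qpinf q q"
    unfolding M using nzQ[of 1]
    by (simp add: N_def aw_prefactor_def power2_eq_square inverse_eq_divide mult_ac)
  finally have lim: "((\<lambda>z. N z / M z) \<longlongrightarrow> aw_prefactor q lam mu a / qpinf q q) (at (a 1))" .
  have "eventually (\<lambda>z. N z / M z = (z - a 1) * (aw_fun q lam mu a z / z)) (at (a 1))"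
    using eventually_neq_at_within[of "a 1"] eventually_neq_at_within[of 0]
  proof eventually_elim
    case (elim z)
    have "qpinf (a 1 / z) q = (z - a 1) / z * qpinf (a 1 * q / z) q"
      using qpinf_step[OF q_less, of "a 1 / z"] elim by (simp add: field_simps)
    moreover have "(\<Prod>j\<in>{1..6}. qpinf (a j * z) q * qpinf (a j / z) q)
       = qpinf (a 1 * z) q * qpinf (a 1 / z) q * (\<Prod>j\<in>{2..6}. qpinf (a j * z) q * qpinf (a j / z) q)"
      by (simp add: prod_1_6[unfolded One_nat_def] prod_2_6 mult_ac)
    ultimately have "aw_fun q lam mu a z = N z / ((z - a 1) / z * M z)"
      unfolding aw_fun_def N_def M_def by (simp add: mult_ac)
    then show ?case
      using elim by simp
  qed
  then show ?thesis
    using lim tendsto_cong by fast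
qed

lemma tendsto_aw_ratio:
  assumes "1 - p\<^sup>2 \<noteq> 0" "1 - lam * p \<noteq> 0" "1 - mu * p \<noteq> 0" "\<And>j. j \<in> {1..6} \<Longrightarrow> a j - q * p \<noteq> 0"
  shows "(aw_ratio q lam mu a \<longlongrightarrow> aw_ratio q lam mu a p) (at p)"
  unfolding aw_ratio_def using assms by (intro tendsto_intros) auto

text \<open>The form dz / z is invariant under z -> q z, so by the difference equation the residue
  at q p is g(p) times the residue at p. The summands obey the same recurrence.\<close>

lemma tendsto_aw_fun_pole:
  "((\<lambda>z. (z - a 1 * q ^ k) * (aw_fun q lam mu a z / z)) \<longlongrightarrow>
     aw_prefactor q lam mu a * aw_summand q lam mu a k / qpinf q q) (at (a 1 * q ^ k))"
proof (induction k)
  case 0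
  then show ?case
    using tendsto_aw_fun_first_pole by (simp add: aw_summand_def)
next
  case (Suc k)
  define p where "p = a 1 * q ^ k"
  define G where "G = (\<lambda>z. (z - p) * (aw_fun q lam mu a z / z))"
  have p: "p \<noteq> 0" "norm p < 1"
    using a_nz[of 1] q_nz norm_a_q_power_less[of 1 k] by (auto simp: p_def)
  have p2: "p\<^sup>2 \<noteq> 1"
    using norm_mult_less[OF p(2) p(2)] by (auto simp: power2_eq_square)
  have pl: "lam * p \<noteq> 1" "mu * p \<noteq> 1"
    using generic_lam[of 1 k] generic_mu[of 1 k] by (auto simp: p_def mult_ac)
  \<comment> \<open>Equality would identify the pole a_j q^0 with a_1 q^(k+1), whose exponent is
    positive; this excludes j = 1 as well.\<close>
  have pa: "a j - q * p \<noteq> 0" if "j \<in> {1..6}" for j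
    using a_q_power_inj[OF that, of 1 0 "Suc k"] by (auto simp: p_def mult_ac)
  have ratio: "(aw_ratio q lam mu a \<longlongrightarrow> aw_ratio q lam mu a p) (at p)"
    using p2 pl pa by (intro tendsto_aw_ratio) auto
  have "((\<lambda>z. aw_ratio q lam mu a z * G z) \<longlongrightarrow> aw_ratio q lam mu a p *
     (aw_prefactor q lam mu a * aw_summand q lam mu a k / qpinf q q)) (at p)"
    unfolding G_def using Suc.IH by (intro tendsto_mult ratio) (simp add: p_def)
  also have "aw_ratio q lam mu a p * (aw_prefactor q lam mu a * aw_summand q lam mu a k / qpinf q q)
     = aw_prefactor q lam mu a * aw_summand q lam mu a (Suc k) / qpinf q q"
    unfolding aw_summand_Suc[OF nz] p_def by simp
  finally have lim: "((\<lambda>z. aw_ratio q lam mu a z * G z) \<longlongrightarrow>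
     aw_prefactor q lam mu a * aw_summand q lam mu a (Suc k) / qpinf q q) (at p)" .
  have ev: "eventually (\<lambda>z. z \<in> ball 0 1 - {0} \<and> lam * z \<noteq> 1 \<and> mu * z \<noteq> 1) (at p)"
  proof (intro eventually_conj)
    show "eventually (\<lambda>z. z \<in> ball 0 1 - {0}) (at p)"
      by (rule eventually_at_in_open') (use p in auto)
    show "eventually (\<lambda>z. lam * z \<noteq> 1) (at p)" "eventually (\<lambda>z. mu * z \<noteq> 1) (at p)"
      using pl by (auto intro!: tendsto_imp_eventually_ne tendsto_intros)
  qed
  have "eventually (\<lambda>z. aw_ratio q lam mu a z * G z
     = (q * z - q * p) * (aw_fun q lam mu a (q * z) / (q * z))) (at p)"
    using ev
  proof eventually_elim
    case (elim z)
    have "aw_fun q lam mu a (q * z) = aw_ratio q lam mu a z * aw_fun q lam mu a z"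
      using elim a_less by (intro aw_fun_q_shift q_nz q_less) auto
    moreover have "(q * z - q * p) * (x / (q * z)) = (z - p) * (x / z)" for x
      using q_nz by (simp flip: right_diff_distrib)
    ultimately show ?case
      by (simp add: G_def)
  qed
  with lim have lim2: "((\<lambda>z. (q * z - q * p) * (aw_fun q lam mu a (q * z) / (q * z))) \<longlongrightarrow>
     aw_prefactor q lam mu a * aw_summand q lam mu a (Suc k) / qpinf q q) (at p)"
    using tendsto_cong by fast
  \<comment> \<open>Substitution z = w / q. The limit is taken over punctured neighbourhoods, so w /
    q must also avoid \<open>p\<close>.\<close>
  have "filterlim (\<lambda>w. w / q) (at p) (at (q * p))"
  proof (rule filterlim_atI)
    show "((\<lambda>w. w / q) \<longlongrightarrow> p) (at (q * p))"
      using q_nz by (auto intro!: tendsto_eq_intros)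
    show "eventually (\<lambda>w. w / q \<noteq> p) (at (q * p))"
      using eventually_neq_at_within[of "q * p"]
      by eventually_elim (use q_nz in \<open>auto simp: field_simps\<close>)
  qed
  from filterlim_compose[OF lim2 this] show ?case
    using q_nz by (simp add: p_def mult_ac)
qed

section \<open>Contraction near the origin and convergence of the series\<close>

lemma tendsto_aw_ratio_0:
  "(aw_ratio q lam mu a \<longlongrightarrow> q * lam * mu / (\<Prod>j\<in>{1..6}. a j)) (at 0)"
proof -
  have "aw_ratio q lam mu a 0 = q * lam * mu / (\<Prod>j\<in>{1..6}. a j)"
    by (simp add: aw_ratio_def prod_dividef)
  moreover have "(aw_ratio q lam mu a \<longlongrightarrow> aw_ratio q lam mu a 0) (at 0)"
    by (rule tendsto_aw_ratio) (use a_nz in auto)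
  ultimately show ?thesis by simp
qed

text \<open>Here \<open>r\<close> is any number strictly between |g(0)| and 1, and \<open>d\<close>
  is small enough that the difference equation applies as well. Both the ratio test and the decay on
  small circles rest on this.\<close>

lemma aw_ratio_contraction:
  obtains d r where "0 < d" "0 \<le> r" "r < 1"
    "\<And>z. z \<noteq> 0 \<Longrightarrow> norm z < d \<Longrightarrow> norm (aw_ratio q lam mu a z) \<le> r"
    "\<And>z. z \<noteq> 0 \<Longrightarrow> norm z < d \<Longrightarrow> norm z < 1 \<and> lam * z \<noteq> 1 \<and> mu * z \<noteq> 1"
proof -
  define g where "g = q * lam * mu / (\<Prod>j\<in>{1..6}. a j)"
  have "(\<Prod>j\<in>{1..6}. a j) \<noteq> 0"
    using a_nz by simp
  then have "norm g < 1"
    using prod_less by (simp add: g_def norm_divide)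
  then obtain r where r: "norm g < r" "r < 1"
    using dense by blast
  have "eventually (\<lambda>z. norm (aw_ratio q lam mu a z) < r \<and> z \<in> ball 0 1 \<and> lam * z \<noteq> 1 \<and> mu * z \<noteq> 1) (at 0)"
  proof (intro eventually_conj)
    show "eventually (\<lambda>z. norm (aw_ratio q lam mu a z) < r) (at 0)"
      using tendsto_norm[OF tendsto_aw_ratio_0] r(1) unfolding g_def by (rule order_tendstoD)
    show "eventually (\<lambda>z::complex. z \<in> ball 0 1) (at 0)"
      by (rule eventually_at_in_open') auto
    show "eventually (\<lambda>z. lam * z \<noteq> 1) (at 0)"
      by (rule tendsto_imp_eventually_ne[where c = "lam * 0"], intro tendsto_intros) simp
    show "eventually (\<lambda>z. mu * z \<noteq> 1) (at 0)"
      by (rule tendsto_imp_eventually_ne[where c = "mu * 0"], intro tendsto_intros) simp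
  qed
  then obtain d where "d > 0" and d: "\<And>z. z \<noteq> 0 \<Longrightarrow> norm z < d \<Longrightarrow>
      norm (aw_ratio q lam mu a z) < r \<and> z \<in> ball 0 1 \<and> lam * z \<noteq> 1 \<and> mu * z \<noteq> 1"
    unfolding eventually_at by (auto simp: dist_norm)
  show ?thesis
  proof (rule that)
    show "0 < d" "r < 1" by fact+
    show "0 \<le> r" using r norm_ge_zero[of g] by linarith
    show "norm (aw_ratio q lam mu a z) \<le> r" if "z \<noteq> 0" "norm z < d" for z
      using d[OF that] by simp
    show "norm z < 1 \<and> lam * z \<noteq> 1 \<and> mu * z \<noteq> 1" if "z \<noteq> 0" "norm z < d" for z
      using d[OF that] by simp
  qed
qed

lemma summable_norm_aw_summand: "summable (\<lambda>k. norm (aw_summand q lam mu a k))"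
proof -
  obtain d r where d: "0 < d" "0 \<le> r" "r < 1"
    "\<And>z. z \<noteq> 0 \<Longrightarrow> norm z < d \<Longrightarrow> norm (aw_ratio q lam mu a z) \<le> r"
    using aw_ratio_contraction by metis
  have "(\<lambda>k. norm (a 1 * q ^ k)) \<longlonglongrightarrow> norm (a 1 * 0)"
    by (intro tendsto_intros LIMSEQ_power_zero q_less)
  then have "eventually (\<lambda>k. norm (a 1 * q ^ k) < d) sequentially"
    using d(1) by (intro order_tendstoD(2)) auto
  then obtain N where N: "\<And>k. k \<ge> N \<Longrightarrow> norm (a 1 * q ^ k) < d"
    by (auto simp: eventually_sequentially)
  show ?thesis
  proof (rule summable_ratio_test[OF d(3)])
    fix k assume "N \<le> k"
    have "norm (aw_ratio q lam mu a (a 1 * q ^ k)) \<le> r"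
      by (rule d(4)[OF _ N[OF \<open>N \<le> k\<close>]]) (use q_nz a_nz in auto)
    then show "norm (norm (aw_summand q lam mu a (Suc k))) \<le> r * norm (norm (aw_summand q lam mu a k))"
      unfolding aw_summand_Suc[OF nz] by (simp add: norm_mult mult_right_mono)
  qed
qed

end

section \<open>Exchanging parameters, and sums over growing index sets\<close>

text \<open>For i = 1 the transposition is the identity, so summing over all six
  \<open>swp a i\<close> gives the unexchanged term and the five exchanged ones.\<close>

lemma swp_eq_transpose: "swp a i = a \<circ> Transposition.transpose 1 i"
  by (auto simp: swp_def Transposition.transpose_def)

lemma prod_swp:
  assumes "i \<in> {1..6}"
  shows "(\<Prod>j\<in>{1..6}. h (swp a i j)) = (\<Prod>j\<in>{1..6}. h (a j))"
proof -
  have "bij_betw (Transposition.transpose 1 i) {1..6} {1..6}"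
    using assms by (intro bij_betw_transpose_iff) auto
  from prod.reindex_bij_betw[OF this, of "\<lambda>j. h (a j)"] show ?thesis
    by (simp add: swp_eq_transpose)
qed

lemma aw_fun_swp: "i \<in> {1..6} \<Longrightarrow> aw_fun q lam mu (swp a i) = aw_fun q lam mu a"
  unfolding aw_fun_def by (intro ext) (simp only: prod_swp[where h = "\<lambda>x. qpinf (x * _) q * qpinf (x / _) q"])

text \<open>By absolute convergence the series is also an unordered sum, so the shape of the finite
  sets is irrelevant once each index eventually belongs to them. The sets in question are the
  indices of the poles outside a shrinking circle.\<close>

lemma summable_norm_imp_tendsto_sum_sets:
  fixes f :: "nat \<Rightarrow> 'a :: banach"
  assumes "summable (\<lambda>k. norm (f k))" "\<And>n. finite (K n)" "\<And>k. eventually (\<lambda>n. k \<in> K n) sequentially"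
  shows "(\<lambda>n. \<Sum>k\<in>K n. f k) \<longlonglongrightarrow> (\<Sum>k. f k)"
proof -
  have "(f has_sum (\<Sum>k. f k)) UNIV"
    using assms(1) summable_norm_cancel[OF assms(1)]
    by (intro norm_summable_imp_has_sum) (auto simp: summable_sums)
  moreover have "filterlim K (finite_subsets_at_top UNIV) sequentially"
    unfolding filterlim_finite_subsets_at_top
  proof (intro allI impI)
    fix X :: "nat set" assume "finite X \<and> X \<subseteq> UNIV"
    then have "eventually (\<lambda>n. \<forall>k\<in>X. k \<in> K n) sequentially"
      using assms(3) by (simp add: eventually_ball_finite)
    then show "eventually (\<lambda>n. finite (K n) \<and> X \<subseteq> K n \<and> K n \<subseteq> UNIV) sequentially"
      by eventually_elim (auto simp: assms(2))
  qed
  ultimately show ?thesis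
    unfolding has_sum_def by (rule filterlim_compose)
qed

section \<open>Residues at all six families of poles\<close>

context aw_params
begin

lemma aw_params_swp:
  assumes i: "i \<in> {1..6}"
  shows "aw_params q lam mu (swp a i)"
proof -
  define \<pi> where "\<pi> = Transposition.transpose 1 i"
  have \<pi>: "\<pi> j \<in> {1..6}" if "j \<in> {1..6}" for j
    using that i by (auto simp: \<pi>_def Transposition.transpose_def)
  have inj: "\<pi> j \<noteq> \<pi> k" if "j \<noteq> k" for j k
    using that unfolding \<pi>_def by (metis transpose_involutory)
  have swp: "swp a i j = a (\<pi> j)" for j
    by (simp add: swp_eq_transpose \<pi>_def)
  show ?thesis
  proof
    show "norm (q * lam * mu) < norm (\<Prod>j\<in>{1..6}. swp a i j)"
      using prod_less prod_swp[OF i, of "\<lambda>x. x" a] by simp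
  qed (unfold swp, (rule q_nz q_less lam_nz mu_nz
      | (intro a_nz a_less generic generic_lam generic_mu \<pi> inj; assumption))+)
qed

definition aw_residue :: "nat \<Rightarrow> nat \<Rightarrow> complex" where
  "aw_residue i k = aw_prefactor q lam mu (swp a i) * aw_summand q lam mu (swp a i) k / qpinf q q"

lemma tendsto_aw_residue:
  assumes "i \<in> {1..6}"
  shows "((\<lambda>z. (z - a i * q ^ k) * (aw_fun q lam mu a z / z)) \<longlongrightarrow> aw_residue i k) (at (a i * q ^ k))"
proof -
  interpret s: aw_params q lam mu "swp a i"
    by (rule aw_params_swp[OF assms])
  have "swp a i 1 = a i"
    by (simp add: swp_def)
  then show ?thesis
    using s.tendsto_aw_fun_pole[of k] unfolding aw_residue_def aw_fun_swp[OF assms] by simp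
qed

lemma summable_norm_aw_residue:
  assumes "i \<in> {1..6}"
  shows "summable (\<lambda>k. norm (aw_residue i k))"
proof -
  interpret s: aw_params q lam mu "swp a i"
    by (rule aw_params_swp[OF assms])
  show ?thesis
    using summable_mult[OF s.summable_norm_aw_summand, of "norm (aw_prefactor q lam mu (swp a i) / qpinf q q)"]
    by (simp add: aw_residue_def norm_mult norm_divide)
qed

lemma suminf_aw_residue:
  assumes "i \<in> {1..6}"
  shows "(\<Sum>k. aw_residue i k) = term2p6 q lam mu (swp a i) / qpinf q q"
proof -
  interpret s: aw_params q lam mu "swp a i"
    by (rule aw_params_swp[OF assms])
  have "(\<Sum>k. aw_prefactor q lam mu (swp a i) / qpinf q q * aw_summand q lam mu (swp a i) k)
    = aw_prefactor q lam mu (swp a i) / qpinf q q * (\<Sum>k. aw_summand q lam mu (swp a i) k)"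
    by (rule suminf_mult[OF summable_norm_cancel[OF s.summable_norm_aw_summand]])
  then show ?thesis
    by (simp add: aw_residue_def term2p6_eq)
qed

section \<open>Shrinking the circle\<close>

definition aw_denom :: "complex \<Rightarrow> complex" where
  "aw_denom z = (\<Prod>j\<in>{1..6}. qpinf (a j * z) q * qpinf (a j / z) q)"

lemma holomorphic_on_aw_denom: "aw_denom holomorphic_on - {0}"
  unfolding aw_denom_def by (intro holomorphic_intros holomorphic_on_qpinf_compose q_less) auto

lemma holomorphic_on_aw_fun:
  "(\<lambda>z. aw_fun q lam mu a z / z) holomorphic_on {z. z \<noteq> 0 \<and> aw_denom z \<noteq> 0}"
  unfolding aw_fun_def aw_denom_def
  by (intro holomorphic_intros holomorphic_on_qpinf_compose q_less) auto

text \<open>For |z| at most 1 the products in a_j z cannot vanish, since |a_j z| < 1; their zeros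
  lie outside the closed disc. Only the products in a_j / z remain.\<close>

lemma aw_denom_eq_0_iff:
  assumes "z \<noteq> 0" "norm z \<le> 1"
  shows "aw_denom z = 0 \<longleftrightarrow> (\<exists>i\<in>{1..6}. \<exists>k. z = a i * q ^ k)"
proof -
  have "qpinf (a j * z) q \<noteq> 0" if "j \<in> {1..6}" for j
  proof (rule qpinf_nonzero[OF q_less])
    have "norm (a j) * norm z \<le> norm (a j) * 1"
      using assms by (intro mult_left_mono) auto
    then show "norm (a j * z) < 1"
      using a_less[OF that] by (simp add: norm_mult)
  qed
  moreover have "qpinf (a j / z) q = 0 \<longleftrightarrow> (\<exists>k. z = a j * q ^ k)" for j
    using assms qpinf_eq_0_iff[OF q_less, of "a j / z"] by (auto simp: field_simps)
  ultimately show ?thesis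
    by (auto simp: aw_denom_def)
qed

lemma aw_denom_isolated_zero:
  assumes "p \<noteq> 0" "aw_denom p = 0"
  obtains e where "e > 0" "\<And>z. z \<in> ball p e \<Longrightarrow> z \<noteq> 0" "\<And>z. z \<in> ball p e - {p} \<Longrightarrow> aw_denom z \<noteq> 0"
proof -
  \<comment> \<open>The point 1 shows that \<open>aw_denom\<close> is not identically zero on the
    connected punctured plane, which is what isolates its zeros.\<close>
  have "aw_denom 1 \<noteq> 0"
    using a_less by (auto simp: aw_denom_def qpinf_nonzero[OF q_less])
  then obtain e where "e > 0" "ball p e \<subseteq> - {0}" "\<And>z. z \<in> ball p e - {p} \<Longrightarrow> aw_denom z \<noteq> 0"
    using isolated_zeros[OF holomorphic_on_aw_denom _ _ _ assms(2), of 1]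
      connected_punctured_universe[of "0::complex"] assms(1)
    by (auto simp: open_Compl)
  then show ?thesis
    by (intro that[of e]) auto
qed

lemma contour_integral_aw_fun_shrink:
  assumes r: "0 < r" "r < 1" and avoid: "\<And>i k. i \<in> {1..6} \<Longrightarrow> norm (a i * q ^ k) \<noteq> r"
  shows "finite {k. r < norm (a i * q ^ k)}"
    and "contour_integral (circlepath 0 1) (\<lambda>z. aw_fun q lam mu a z / z)
      = contour_integral (circlepath 0 r) (\<lambda>z. aw_fun q lam mu a z / z)
        + 2 * pi * \<i> * (\<Sum>i\<in>{1..6}. \<Sum>k\<in>{k. r < norm (a i * q ^ k)}. aw_residue i k)"
proof -
  define F where "F = (\<lambda>z. aw_fun q lam mu a z / z)"
  define K where "K = (\<lambda>i. {k. r < norm (a i * q ^ k)})"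
  have fin: "finite (K i)" for i
  proof -
    have "(\<lambda>k. norm (a i * q ^ k)) \<longlonglongrightarrow> norm (a i * 0)"
      by (intro tendsto_intros LIMSEQ_power_zero q_less)
    then have "eventually (\<lambda>k. norm (a i * q ^ k) < r) sequentially"
      using r(1) by (intro order_tendstoD(2)) auto
    then obtain N where N: "\<And>k. k \<ge> N \<Longrightarrow> norm (a i * q ^ k) < r"
      by (auto simp: eventually_sequentially)
    have "K i \<subseteq> {..<N}"
    proof
      fix k assume "k \<in> K i"
      then show "k \<in> {..<N}"
        using N[of k] by (cases "k < N") (auto simp: K_def)
    qed
    then show ?thesis
      using finite_subset by blast
  qed
  then show "finite {k. r < norm (a i * q ^ k)}"
    by (simp add: K_def)
  define pole where "pole = (\<lambda>(i, k). a i * q ^ k)"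
  define P where "P = pole ` (SIGMA i:{1..6}. K i)"
  \<comment> \<open>Only the poles in the annulus are added back. Those closer to 0 or outside the
    unit disc stay out of \<open>S\<close>, so that finitely many singularities remain.\<close>
  define S where "S = {z. z \<noteq> 0 \<and> aw_denom z \<noteq> 0} \<union> P"
  have inj: "inj_on pole (SIGMA i:{1..6}. K i)"
    unfolding inj_on_def pole_def using a_q_power_inj by fastforce
  have P: "p \<noteq> 0 \<and> r < norm p \<and> norm p < 1 \<and> aw_denom p = 0" if pP: "p \<in> P" for p
  proof -
    obtain i k where ik: "i \<in> {1..6}" "k \<in> K i" "p = a i * q ^ k"
      using pP by (auto simp: P_def pole_def)
    have "p \<noteq> 0"
      using ik a_nz[OF ik(1)] q_nz by simp
    moreover have "norm p < 1"
      using ik norm_a_q_power_less by simp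
    ultimately show ?thesis
      using ik aw_denom_eq_0_iff[of p] by (auto simp: K_def)
  qed
  \<comment> \<open>The residues are indexed by pairs, but the annulus lemma expects a function of
    the point. \<open>Lim\<close> supplies one, and injectivity of \<open>pole\<close> translates
    back afterwards.\<close>
  have "contour_integral (circlepath 0 1) F
      = contour_integral (circlepath 0 r) F + 2 * pi * \<i> * (\<Sum>p\<in>P. Lim (at p) (\<lambda>z. (z - p) * F z))"
  proof (rule contour_integral_annulus_residues)
    show "finite P"
      unfolding P_def using fin by auto
    show "open S"
      unfolding open_contains_ball
    proof
      fix z assume z: "z \<in> S"
      show "\<exists>e>0. ball z e \<subseteq> S"
      proof (cases "z \<in> P")
        case True
        with P[of z] obtain e where "e > 0" "\<And>w. w \<in> ball z e \<Longrightarrow> w \<noteq> 0"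
          "\<And>w. w \<in> ball z e - {z} \<Longrightarrow> aw_denom w \<noteq> 0"
          using aw_denom_isolated_zero by metis
        with True have "ball z e \<subseteq> S"
          unfolding S_def by blast
        with \<open>e > 0\<close> show ?thesis
          by blast
      next
        case False
        have "open (- {0} \<inter> aw_denom -` (- {0}))"
          using holomorphic_on_imp_continuous_on[OF holomorphic_on_aw_denom]
          by (intro continuous_open_preimage) (auto simp: open_Compl)
        moreover have "z \<in> (- {0} \<inter> aw_denom -` (- {0}))"
          using z False by (auto simp: S_def)
        ultimately obtain e where "e > 0" "ball z e \<subseteq> (- {0} \<inter> aw_denom -` (- {0}))"
          unfolding open_contains_ball by blast
        then show ?thesis
          by (intro exI[of _ e]) (auto simp: S_def)
      qed
    qed
    show "z \<in> S" if z: "r \<le> norm z" "norm z \<le> 1" for z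
    proof (rule ccontr)
      assume "z \<notin> S"
      moreover have "z \<noteq> 0"
        using z r by auto
      ultimately obtain i k where ik: "i \<in> {1..6}" "z = a i * q ^ k"
        using z aw_denom_eq_0_iff[of z] by (auto simp: S_def)
      \<comment> \<open>A pole in the closed annulus cannot have modulus exactly \<open>r\<close>,
        by \<open>avoid\<close>, so it is one of those counted.\<close>
      then have "k \<in> K i"
        using avoid[OF ik(1), of k] z by (auto simp: K_def)
      then have "z \<in> P"
        using ik by (auto simp: P_def pole_def)
      then show False
        using \<open>z \<notin> S\<close> by (simp add: S_def)
    qed
    show "F holomorphic_on (S - P)"
      unfolding F_def by (rule holomorphic_on_subset[OF holomorphic_on_aw_fun]) (auto simp: S_def)
    show "((\<lambda>z. (z - p) * F z) \<longlongrightarrow> Lim (at p) (\<lambda>z. (z - p) * F z)) (at p)" if pP: "p \<in> P" for p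
    proof -
      obtain i k where "i \<in> {1..6}" "k \<in> K i" "p = a i * q ^ k"
        using pP by (auto simp: P_def pole_def)
      then show ?thesis
        using tendsto_aw_residue[of i k] by (auto simp: F_def tendsto_Lim)
    qed
  qed (use r P in auto)
  also have "(\<Sum>p\<in>P. Lim (at p) (\<lambda>z. (z - p) * F z)) = (\<Sum>(i, k)\<in>(SIGMA i:{1..6}. K i). aw_residue i k)"
    unfolding P_def sum.reindex[OF inj] o_def
  proof (rule sum.cong[OF refl])
    fix x assume x: "x \<in> (SIGMA i:{1..6}. K i)"
    obtain i k where ik: "x = (i, k)"
      by (cases x)
    with x have "i \<in> {1..6}"
      by blast
    from tendsto_Lim[OF _ tendsto_aw_residue[OF this, of k]]
    show "Lim (at (pole x)) (\<lambda>z. (z - pole x) * F z) = (case x of (i, k) \<Rightarrow> aw_residue i k)"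
      by (simp add: ik pole_def F_def)
  qed
  also have "\<dots> = (\<Sum>i\<in>{1..6}. \<Sum>k\<in>K i. aw_residue i k)"
    by (rule sum.Sigma[symmetric]) (auto simp: fin)
  finally show "contour_integral (circlepath 0 1) (\<lambda>z. aw_fun q lam mu a z / z)
      = contour_integral (circlepath 0 r) (\<lambda>z. aw_fun q lam mu a z / z)
        + 2 * pi * \<i> * (\<Sum>i\<in>{1..6}. \<Sum>k\<in>{k. r < norm (a i * q ^ k)}. aw_residue i k)"
    by (simp add: F_def K_def)
qed

text \<open>Division by q maps each circle to the preceding one, so beyond the radius d every step
  costs a factor of at most r < 1. In f(z) / z the factor 1 / |z| is compensated by the length of
  the circle, so the integrals decay like r^m.\<close>

lemma contour_integral_aw_fun_tendsto_0:
  assumes \<rho>: "0 < \<rho>" "\<rho> < 1" and avoid: "\<And>i k n. i \<in> {1..6} \<Longrightarrow> norm (a i * q ^ k) \<noteq> \<rho> * norm q ^ n"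
  shows "(\<lambda>n. contour_integral (circlepath 0 (\<rho> * norm q ^ n)) (\<lambda>z. aw_fun q lam mu a z / z)) \<longlonglongrightarrow> 0"
proof -
  define F where "F = (\<lambda>z. aw_fun q lam mu a z / z)"
  define R where "R = (\<lambda>n. \<rho> * norm q ^ n)"
  have R_pos: "0 < R n" for n
    using \<rho> q_nz by (simp add: R_def)
  have R_le: "R n \<le> 1" for n
    unfolding R_def using \<rho> q_less by (intro mult_le_one power_le_one) auto
  obtain d r where d: "0 < d" "0 \<le> r" "r < 1"
    "\<And>z. z \<noteq> 0 \<Longrightarrow> norm z < d \<Longrightarrow> norm (aw_ratio q lam mu a z) \<le> r"
    "\<And>z. z \<noteq> 0 \<Longrightarrow> norm z < d \<Longrightarrow> norm z < 1 \<and> lam * z \<noteq> 1 \<and> mu * z \<noteq> 1"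
    using aw_ratio_contraction by metis
  have "R \<longlonglongrightarrow> \<rho> * 0"
    unfolding R_def by (intro tendsto_intros LIMSEQ_power_zero) (use q_less in auto)
  then have "eventually (\<lambda>n. R n < d) sequentially"
    using d(1) by (intro order_tendstoD(2)) auto
  then obtain N where N: "\<And>n. n \<ge> N \<Longrightarrow> R n < d"
    by (auto simp: eventually_sequentially)
  have Fcont: "continuous_on (sphere 0 (R n)) F" for n
  proof -
    have "sphere 0 (R n) \<subseteq> {z. z \<noteq> 0 \<and> aw_denom z \<noteq> 0}"
    proof
      fix z :: complex assume z: "z \<in> sphere 0 (R n)"
      then have "z \<noteq> 0" using R_pos[of n] by auto
      moreover have "aw_denom z \<noteq> 0"
        using aw_denom_eq_0_iff[OF \<open>z \<noteq> 0\<close>] R_le[of n] z avoid[of _ _ n] by (auto simp: R_def)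
      ultimately show "z \<in> {z. z \<noteq> 0 \<and> aw_denom z \<noteq> 0}" by simp
    qed
    then show ?thesis
      unfolding F_def
      using holomorphic_on_imp_continuous_on[OF holomorphic_on_aw_fun] continuous_on_subset by blast
  qed
  \<comment> \<open>The induction along the circles starts from compactness of a single circle, the
    one with index \<open>N\<close>, from which on the contraction is available.\<close>
  have "bounded (F ` sphere 0 (R N))"
    using Fcont by (intro compact_imp_bounded compact_continuous_image) auto
  then obtain B where B: "B > 0" "\<And>z. norm z = R N \<Longrightarrow> norm (F z) \<le> B"
    by (auto simp: bounded_pos)
  have bound: "norm (aw_fun q lam mu a z) \<le> B * R N * r ^ m" if "norm z = R (N + m)" for z m
    using that
  proof (induction m arbitrary: z)
    case 0
    then have "norm z > 0"
      using R_pos[of N] by simp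
    then have "norm (aw_fun q lam mu a z) = norm (F z) * norm z"
      by (simp add: F_def norm_divide)
    also have "\<dots> \<le> B * R N"
      using B(2)[of z] 0 R_pos[of N] by (auto intro!: mult_right_mono)
    finally show ?case by simp
  next
    case (Suc m)
    define w where "w = z / q"
    have w: "norm w = R (N + m)"
      using Suc.prems q_nz by (simp add: w_def norm_divide R_def)
    then have "w \<noteq> 0" "norm w < d"
      using R_pos[of "N + m"] N[of "N + m"] by auto
    have "aw_fun q lam mu a (q * w) = aw_ratio q lam mu a w * aw_fun q lam mu a w"
      using d(5)[OF \<open>w \<noteq> 0\<close> \<open>norm w < d\<close>] a_less \<open>w \<noteq> 0\<close> by (intro aw_fun_q_shift q_nz q_less) auto
    then have "norm (aw_fun q lam mu a z) = norm (aw_ratio q lam mu a w) * norm (aw_fun q lam mu a w)"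
      using q_nz by (simp add: w_def norm_mult)
    also have "\<dots> \<le> r * (B * R N * r ^ m)"
      using d(4)[OF \<open>w \<noteq> 0\<close> \<open>norm w < d\<close>] Suc.IH[OF w] d(2) by (intro mult_mono) auto
    finally show ?case
      by (simp add: mult_ac)
  qed
  have "(\<lambda>m. contour_integral (circlepath 0 (R (m + N))) F) \<longlonglongrightarrow> 0"
  proof (rule Lim_null_comparison)
    show "eventually (\<lambda>m. norm (contour_integral (circlepath 0 (R (m + N))) F) \<le> B * R N * 2 * pi * r ^ m) sequentially"
    proof (intro always_eventually allI)
      fix m
      have "norm (contour_integral (circlepath 0 (R (m + N))) F)
        \<le> (B * R N * r ^ m / R (m + N)) * (2 * pi * R (m + N))"
      proof (rule has_contour_integral_bound_circlepath)
        show "(F has_contour_integral contour_integral (circlepath 0 (R (m + N))) F) (circlepath 0 (R (m + N)))"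
          using Fcont R_pos[of "m + N"]
          by (intro has_contour_integral_integral contour_integrable_continuous_circlepath)
            (simp add: path_image_circlepath)
        show "norm (F z) \<le> B * R N * r ^ m / R (m + N)" if "norm (z - 0) = R (m + N)" for z
          using bound[of z m] that R_pos[of "m + N"]
          by (simp add: F_def norm_divide add.commute divide_right_mono)
        show "0 \<le> B * R N * r ^ m / R (m + N)"
          using B R_pos[of "m + N"] R_pos[of N] d(2) by simp
      qed (rule R_pos)
      then show "norm (contour_integral (circlepath 0 (R (m + N))) F) \<le> B * R N * 2 * pi * r ^ m"
        using R_pos[of "m + N"] by (simp add: mult_ac)
    qed
    show "(\<lambda>m. B * R N * 2 * pi * r ^ m) \<longlonglongrightarrow> 0"
      using d by (intro tendsto_mult_right_zero LIMSEQ_power_zero) auto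
  qed
  then show ?thesis
    unfolding F_def R_def by (rule LIMSEQ_offset)
qed

lemma contour_integral_aw_fun_unit_circle:
  "contour_integral (circlepath 0 1) (\<lambda>z. aw_fun q lam mu a z / z)
   = 2 * pi * \<i> / qpinf q q * (\<Sum>i\<in>{1..6}. term2p6 q lam mu (swp a i))"
proof -
  \<comment> \<open>\<open>A\<close> contains every \<rho> for which some circle of radius \<rho>
    |q|^n meets a pole. It is countable, so a suitable \<rho> exists in the unit interval.\<close>
  define A where "A = (\<lambda>(i, k, n). norm (a i * q ^ k) / norm q ^ n) ` (UNIV :: (nat \<times> nat \<times> nat) set)"
  have "countable A"
    unfolding A_def by (rule countable_image) simp
  then obtain \<rho> where \<rho>: "0 < \<rho>" "\<rho> < 1" "\<rho> \<notin> A"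
    using real_interval_avoid_countable_set[of 0 1 A] by auto
  have avoid: "norm (a i * q ^ k) \<noteq> \<rho> * norm q ^ n" for i k n
  proof
    assume "norm (a i * q ^ k) = \<rho> * norm q ^ n"
    then have "\<rho> = norm (a i * q ^ k) / norm q ^ n"
      using q_nz by simp
    then have "\<rho> \<in> A"
      unfolding A_def by (intro image_eqI[of _ _ "(i, k, n)"]) auto
    with \<rho>(3) show False by blast
  qed
  define R where "R = (\<lambda>n. \<rho> * norm q ^ n)"
  define I where "I = (\<lambda>r. contour_integral (circlepath 0 r) (\<lambda>z. aw_fun q lam mu a z / z))"
  have R: "0 < R n" "R n < 1" for n
  proof -
    show "0 < R n"
      using \<rho> q_nz by (simp add: R_def)
    have "R n \<le> \<rho> * 1"
      unfolding R_def using \<rho> q_less by (intro mult_left_mono power_le_one) auto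
    then show "R n < 1"
      using \<rho> by simp
  qed
  have R0: "R \<longlonglongrightarrow> \<rho> * 0"
    unfolding R_def by (intro tendsto_intros LIMSEQ_power_zero) (use q_less in auto)
  have avoidR: "norm (a i * q ^ k) \<noteq> R n" for i k n
    using avoid by (simp add: R_def)
  have eq: "I 1 = I (R n) + 2 * pi * \<i> * (\<Sum>i\<in>{1..6}. \<Sum>k\<in>{k. R n < norm (a i * q ^ k)}. aw_residue i k)" for n
    unfolding I_def by (rule contour_integral_aw_fun_shrink(2)[OF R avoidR])
  have "(\<lambda>n. I (R n) + 2 * pi * \<i> * (\<Sum>i\<in>{1..6}. \<Sum>k\<in>{k. R n < norm (a i * q ^ k)}. aw_residue i k))
    \<longlonglongrightarrow> 0 + 2 * pi * \<i> * (\<Sum>i\<in>{1..6}. \<Sum>k. aw_residue i k)"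
  proof (intro tendsto_intros summable_norm_imp_tendsto_sum_sets summable_norm_aw_residue)
    show "(\<lambda>n. I (R n)) \<longlonglongrightarrow> 0"
      unfolding I_def R_def by (rule contour_integral_aw_fun_tendsto_0[OF \<rho>(1,2) avoid])
    show "finite {k. R n < norm (a i * q ^ k)}" for i n
      by (rule contour_integral_aw_fun_shrink(1)[OF R avoidR])
    show "eventually (\<lambda>n. k \<in> {k. R n < norm (a i * q ^ k)}) sequentially" if "i \<in> {1..6}" for i k
      using order_tendstoD(2)[OF R0, of "norm (a i * q ^ k)"] a_nz[OF that] q_nz by simp
  qed
  \<comment> \<open>By \<open>eq\<close> the sequence is constant, so its limit is the integral over
    the unit circle itself.\<close>
  then have "(\<lambda>n::nat. I 1) \<longlonglongrightarrow> 0 + 2 * pi * \<i> * (\<Sum>i\<in>{1..6}. \<Sum>k. aw_residue i k)"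
    unfolding eq[symmetric] .
  then have "I 1 = 0 + 2 * pi * \<i> * (\<Sum>i\<in>{1..6}. \<Sum>k. aw_residue i k)"
    by (simp add: LIMSEQ_const_iff)
  also have "(\<Sum>i\<in>{1..6}. \<Sum>k. aw_residue i k) = (\<Sum>i\<in>{1..6}. term2p6 q lam mu (swp a i)) / qpinf q q"
    unfolding sum_divide_distrib by (intro sum.cong refl suminf_aw_residue)
  finally show ?thesis
    by (simp add: I_def)
qed

end

section \<open>The integral formula\<close>

lemma integrand2p6_eq: "integrand2p6 q lam mu a \<psi> = aw_fun q lam mu a (cis \<psi>)"
proof -
  have "cis (2 * \<psi>) = (cis \<psi>)\<^sup>2" "cis (- (2 * \<psi>)) = 1 / (cis \<psi>)\<^sup>2" "c * cis (- \<psi>) = c / cis \<psi>" for c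
    by (simp_all add: power2_eq_square cis_mult cis_divide divide_inverse flip: cis_inverse)
  then show ?thesis
    by (simp add: integrand2p6_def aw_fun_def)
qed

text \<open>On the unit circle dz / z = i dt. Since \<open>circlepath\<close> runs over the angles
  from 0 to 2 pi, the part of the integral over negative angles is first moved by one
  period.\<close>

lemma integral_cis_eq_contour_integral:
  assumes "continuous_on (sphere 0 1) f"
  shows "\<i> * integral {-pi..pi} (\<lambda>t. f (cis t)) = contour_integral (circlepath 0 1) (\<lambda>z. f z / z)"
proof -
  have cont: "continuous_on A (\<lambda>t. f (cis t))" for A
    by (rule continuous_on_compose2[OF assms]) (auto intro!: continuous_intros)
  define g where "g = (\<lambda>t. f (cis t))"
  have int: "g integrable_on {u..v}" for u v
    unfolding g_def by (intro integrable_continuous_real cont)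
  have "(g has_integral integral {pi..2*pi} g) (cbox pi (2*pi))"
    using int[of pi "2*pi"] by (simp add: integrable_integral)
  from has_integral_affinity'[OF this, of 1 "2*pi"]
  have "((\<lambda>t. g (t + 2 * pi)) has_integral integral {pi..2*pi} g) {-pi..0}"
    by simp
  moreover have "g (t + 2 * pi) = g t" for t
    by (simp add: g_def flip: cis_mult)
  ultimately have "integral {-pi..0} g = integral {pi..2*pi} g"
    by (simp add: integral_unique)
  then have "integral {-pi..pi} g = integral {0..2*pi} g"
    using Henstock_Kurzweil_Integration.integral_combine[of "-pi" 0 pi g]
      Henstock_Kurzweil_Integration.integral_combine[of 0 pi "2*pi" g] int
    by (simp add: add.commute)
  moreover have "contour_integral (circlepath 0 1) (\<lambda>z. f z / z) = integral {0..2*pi} (\<lambda>t. \<i> * g t)"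
    unfolding circlepath_def by (subst contour_integral_part_circlepath_eq) (auto simp: g_def mult_ac)
  ultimately show ?thesis
    using int[of 0 "2*pi"] by (simp add: g_def)
qed

theorem theorem2p6:
  fixes q lam mu :: complex and a :: "nat \<Rightarrow> complex"
  assumes q: "0 < norm q" "norm q < 1"
    and nz: "\<forall>i\<in>{1..6}. a i \<noteq> 0" "lam \<noteq> 0" "mu \<noteq> 0"
    and small: "\<forall>i\<in>{1..6}. norm (a i) < 1"
    and prodb: "norm (q * lam * mu) < norm (\<Prod>j\<in>{1..6}. a j)"
               "norm (\<Prod>j\<in>{1..6}. a j) < 1"
    and gen: "\<forall>j\<in>{1..6}. \<forall>k\<in>{1..6}. j \<noteq> k \<longrightarrow> (\<forall>m::int. a j / a k \<noteq> q powi m)"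
    and gen2: "\<forall>i\<in>{1..6}. \<forall>n::nat. a i * lam * q ^ n \<noteq> 1 \<and> a i * mu * q ^ n \<noteq> 1"
  shows "integral {-pi..pi} (integrand2p6 q lam mu a)
         = 2 * pi / qpinf q q * (\<Sum>k\<in>{1..6}. term2p6 q lam mu (swp a k))"
proof -
  interpret aw_params q lam mu a
    by standard (use assms in auto)
  have "aw_denom z \<noteq> 0" if "norm z = 1" for z
  proof
    assume "aw_denom z = 0"
    moreover have "z \<noteq> 0"
      using that by auto
    ultimately have "\<exists>i\<in>{1..6}. \<exists>k. z = a i * q ^ k"
      using that aw_denom_eq_0_iff by simp
    then obtain i k where "i \<in> {1..6}" "z = a i * q ^ k"
      by blast
    then show False
      using that norm_a_q_power_less[of i k] by simp
  qed
  \<comment> \<open>Holomorphy is available for f(z) / z, so f is written as that quotient times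
    z.\<close>
  then have "continuous_on (sphere 0 1) (\<lambda>z. aw_fun q lam mu a z / z * z)"
    by (intro continuous_intros
      continuous_on_subset[OF holomorphic_on_imp_continuous_on[OF holomorphic_on_aw_fun]]) auto
  then have "continuous_on (sphere 0 1) (aw_fun q lam mu a)"
    by (rule continuous_on_eq) auto
  then have "\<i> * integral {-pi..pi} (integrand2p6 q lam mu a)
    = 2 * pi * \<i> / qpinf q q * (\<Sum>k\<in>{1..6}. term2p6 q lam mu (swp a k))"
    unfolding integrand2p6_eq
    by (simp add: integral_cis_eq_contour_integral contour_integral_aw_fun_unit_circle)
  then have "\<i> * integral {-pi..pi} (integrand2p6 q lam mu a)
    = \<i> * (2 * pi / qpinf q q * (\<Sum>k\<in>{1..6}. term2p6 q lam mu (swp a k)))"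
    by (simp add: mult_ac)
  then show ?thesis
    unfolding mult_cancel_left by simp
qed

end
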